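(* Let $n,s$ be integers with $(n+2)/3\le s\le n/2$ and let $L=[s]=\{1,\ldots,s\}$. If $\mathcal{F}\subseteq 2^{[n]}$ is $L$-differencing Sperner, i.e. $|A\setminus B|\in L$ for all distinct $A,B\in\mathcal{F}$, then $$|\mathcal{F}|\le\sum_{i=3s-n-1}^{s}\binom{n-1}{i}.$$
   Context: $[n]=\{1,\ldots,n\}$ and $2^{[n]}$ is the family of all subsets of $[n]$. *)

theory Defs
  imports Main
begin

definition L_differencing_Sperner :: "nat set \<Rightarrow> nat set set \<Rightarrow> bool" where
  "L_differencing_Sperner L F \<longleftrightarrow> (\<forall>A\<in>F. \<forall>B\<in>F. A \<noteq> B \<longrightarrow> card (A - B) \<in> L)"

end

theory Submission
  imports Defs Complex_Main "HOL-Library.Function_Algebras"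
begin

text \<open>
  Replacing the sets of minimum size \<open>k < s\<close> by their upper shadow keeps the
  hypothesis and does not decrease the number of sets; doing this for \<open>F\<close> and for the family of
  complements reduces the problem to families whose sets have sizes in \<open>[s, n - s]\<close>.

  For such a family fix a point \<open>v\<close> and put \<open>W = V - {v}\<close>. In the space of polynomial functions
  of degree at most \<open>s\<close> in the \<open>n - 1\<close> variables indexed by \<open>W\<close>, consider
  \<open>f\<^sub>A(X) = (\<Prod>l=1..s. \<bar>A - {v} - X\<bar> - l)\<close> for \<open>A \<in> F\<close>, together with
  \<open>h\<^sub>I(X) = x\<^sub>I (\<Prod>k=s..n-s+1. \<bar>X\<bar> + 1 - k)\<close> for \<open>I \<subseteq> W\<close> with \<open>\<bar>I\<bar> \<le> 3s - n - 2\<close>.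
  Every \<open>h\<^sub>I\<close> vanishes at all points \<open>B - {v}\<close> with \<open>B \<in> F\<close>. Evaluating a linear relation at
  \<open>B - {v}\<close>, first for the \<open>B\<close> containing \<open>v\<close> and then for the others, kills the coefficients of
  the \<open>f\<^sub>A\<close>, and evaluating it at small sets kills those of the \<open>h\<^sub>I\<close>.
\<close>

section \<open>Confining the set sizes\<close>

text \<open>Excluding difference size 0 is the antichain condition. The replacement step below
  checks it separately from the upper bound \<open>s\<close>.\<close>

lemma L_differencing_Sperner_iff:
  assumes "F \<subseteq> Pow V" "finite V"
  shows "L_differencing_Sperner {1..s} F \<longleftrightarrow>
    (\<forall>A\<in>F. \<forall>B\<in>F. A \<noteq> B \<longrightarrow> \<not> A \<subseteq> B \<and> card (A - B) \<le> s)"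
proof -
  have "card (A - B) \<in> {1..s} \<longleftrightarrow> \<not> A \<subseteq> B \<and> card (A - B) \<le> s" if "A \<in> F" for A B
  proof -
    have "finite (A - B)" using assms that by (meson PowD finite_Diff finite_subset subsetD)
    then have "card (A - B) = 0 \<longleftrightarrow> A \<subseteq> B" by auto
    then show ?thesis by auto
  qed
  then show ?thesis unfolding L_differencing_Sperner_def by blast
qed

definition upper_shadow :: "'a set \<Rightarrow> 'a set set \<Rightarrow> 'a set set" where
  "upper_shadow V G = {insert x A | x A. A \<in> G \<and> x \<in> V - A}"

lemma upper_shadowE:
  assumes "B \<in> upper_shadow V G"
  obtains x A where "B = insert x A" "A \<in> G" "x \<in> V - A"
  using assms unfolding upper_shadow_def mem_Collect_eq by (elim exE conjE) (rule that)

lemma upper_shadow_subset: "G \<subseteq> Pow V \<Longrightarrow> upper_shadow V G \<subseteq> Pow V"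
  by (auto simp: upper_shadow_def)

text \<open>Double counting of pairs \<open>A \<subseteq> B\<close>: each \<open>A\<close> lies in
  at least \<open>card V - k\<close> shadow sets, each shadow set contains at most
  \<open>k + 1\<close> members of \<open>G\<close>, and \<open>2 * k < card V\<close> gives
  \<open>k + 1 \<le> card V - k\<close>.\<close>

lemma card_upper_shadow_ge:
  assumes "finite V" "G \<subseteq> Pow V" "\<And>A. A \<in> G \<Longrightarrow> card A = k" "2 * k < card V"
  shows "card G \<le> card (upper_shadow V G)"
proof -
  let ?S = "upper_shadow V G"
  have finS: "finite ?S" and finG: "finite G"
    using upper_shadow_subset[OF assms(2)] assms(1,2) by (meson finite_Pow_iff finite_subset)+
  have fin: "finite A" if "A \<in> G" for A
    using that assms(1,2) by (meson PowD finite_subset subsetD)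
  have up: "card {B\<in>?S. A \<subseteq> B} \<ge> card V - k" if A: "A \<in> G" for A
  proof -
    have "(\<lambda>x. insert x A) ` (V - A) \<subseteq> {B\<in>?S. A \<subseteq> B}"
      using A by (auto simp: upper_shadow_def)
    moreover have "inj_on (\<lambda>x. insert x A) (V - A)"
      by (auto simp: inj_on_def)
    moreover have "finite {B\<in>?S. A \<subseteq> B}" using finS by simp
    ultimately have "card (V - A) \<le> card {B\<in>?S. A \<subseteq> B}"
      by (metis card_image card_mono)
    moreover have "card (V - A) = card V - k"
      using A assms(2) by (subst card_Diff_subset[OF fin[OF A]]) (auto simp: assms(3))
    ultimately show ?thesis by simp
  qed
  have down: "card {A\<in>G. A \<subseteq> B} \<le> k + 1" if B: "B \<in> ?S" for B
  proof -
    obtain x A where xA: "B = insert x A" "A \<in> G" "x \<in> V - A"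
      using B by (rule upper_shadowE)
    then have B': "finite B" "card B = k + 1" using fin assms(3) by auto
    have "{A\<in>G. A \<subseteq> B} \<subseteq> (\<lambda>y. B - {y}) ` B"
    proof
      fix C assume C: "C \<in> {A\<in>G. A \<subseteq> B}"
      then have "card (B - C) = 1"
        using B' fin assms(3) by (simp add: card_Diff_subset)
      then obtain y where "B - C = {y}" by (meson card_1_singletonE)
      then show "C \<in> (\<lambda>y. B - {y}) ` B" using C by blast
    qed
    then have "card {A\<in>G. A \<subseteq> B} \<le> card ((\<lambda>y. B - {y}) ` B)"
      using B' by (intro card_mono) auto
    then show ?thesis using card_image_le[OF B'(1), of "\<lambda>y. B - {y}"] B'(2) by linarith
  qed
  have "card G * (k + 1) \<le> card G * (card V - k)"
    using assms(4) by (intro mult_le_mono2) linarith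
  also have "\<dots> = (\<Sum>A\<in>G. card V - k)"
    by simp
  also have "\<dots> \<le> (\<Sum>A\<in>G. card {B\<in>?S. A \<subseteq> B})"
    using up by (intro sum_mono) auto
  also have "\<dots> = (\<Sum>B\<in>?S. card {A\<in>G. A \<subseteq> B})"
    by (rule sum_multicount_gen[OF finG finS]) simp
  also have "\<dots> \<le> (\<Sum>B\<in>?S. k + 1)"
    using down by (intro sum_mono) auto
  also have "\<dots> = card ?S * (k + 1)"
    by simp
  finally show ?thesis by (metis add_gr_0 mult_le_cancel2 zero_less_one)
qed

text \<open>Level \<open>k\<close> is replaced by its upper shadow. A shadow set \<open>B\<close>
  has size \<open>k + 1 \<le> s\<close>, so \<open>B - C\<close> is never too large; if
  \<open>B\<close> lies above \<open>A\<close> in \<open>G\<close>, then \<open>C - B\<close> is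
  contained in \<open>C - A\<close>.\<close>

lemma raise_minimum_size_step:
  fixes V :: "nat set"
  assumes V: "finite V" "2 * s \<le> card V" and ks: "k < s" "s \<le> m"
    and F: "F \<subseteq> Pow V" "L_differencing_Sperner {1..s} F" "\<And>A. A \<in> F \<Longrightarrow> card A \<in> {k..m}"
  shows "\<exists>F'. F' \<subseteq> Pow V \<and> L_differencing_Sperner {1..s} F' \<and>
           (\<forall>A\<in>F'. card A \<in> {Suc k..m}) \<and> card F \<le> card F'"
proof -
  define G where "G = {A\<in>F. card A = k}"
  define S where "S = upper_shadow V G"
  have GV: "G \<subseteq> Pow V" using F(1) by (auto simp: G_def)
  have SV: "S \<subseteq> Pow V" unfolding S_def by (rule upper_shadow_subset[OF GV])
  have fin: "finite A" if "A \<subseteq> V" for A using V(1) that finite_subset by blast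
  have finF: "finite F" "finite S"
    using F(1) SV V(1) by (meson finite_Pow_iff finite_subset)+
  note D = F(2)[unfolded L_differencing_Sperner_iff[OF F(1) V(1)], rule_format]
  have SE: "\<exists>A\<in>G. A \<subset> B \<and> finite B \<and> card B = Suc k" if B: "B \<in> S" for B
  proof -
    obtain x A where xA: "B = insert x A" "A \<in> G" "x \<in> V - A"
      using B unfolding S_def by (rule upper_shadowE)
    then have "finite A" using GV fin by blast
    then show ?thesis using xA by (intro bexI[of _ A]) (auto simp: G_def)
  qed
  have SF: "\<not> B \<subseteq> C" if BC: "B \<in> S" "C \<in> F" for B C
  proof
    assume "B \<subseteq> C"
    then obtain A where "A \<in> F" "A \<subset> C" using SE[OF BC(1)] by (auto simp: G_def)
    then show False using D[of A C] BC(2) by blast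
  qed
  have FS: "\<not> C \<subseteq> B \<and> card (C - B) \<le> s" if B: "B \<in> S" and C: "C \<in> F - G" for B C
  proof -
    obtain A where A: "A \<in> G" "A \<subset> B" "finite B" "card B = Suc k" using SE[OF B] by blast
    have k: "Suc k \<le> card C" using C F(3)[of C] by (force simp: G_def)
    have AC: "\<not> C \<subseteq> A \<and> card (C - A) \<le> s" using D[of C A] A C by (auto simp: G_def)
    have "finite C" using C F(1) fin by auto
    then have "card (C - B) \<le> card (C - A)" using A(2) by (intro card_mono) auto
    moreover have "\<not> C \<subseteq> B"
    proof
      assume "C \<subseteq> B"
      \<comment> \<open>Sets left in \<open>F - G\<close> have at least
        \<open>k + 1 = card B\<close> elements.\<close>
      then have "C = B" using k A by (simp add: card_seteq)
      then show False using SF[OF B, of C] C by auto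
    qed
    ultimately show ?thesis using AC by simp
  qed
  have Scard: "card (B - C) \<le> s" if "B \<in> S" for B C
    using SE[OF that] ks card_mono[of B "B - C"] by fastforce
  have SS: "\<not> B \<subseteq> C" if "B \<in> S" "C \<in> S" "B \<noteq> C" for B C
    using SE[OF that(1)] SE[OF that(2)] that(3) by (metis card_subset_eq)
  define F' where "F' = (F - G) \<union> S"
  have F'V: "F' \<subseteq> Pow V" using F(1) SV by (auto simp: F'_def)
  have "L_differencing_Sperner {1..s} F'"
    unfolding L_differencing_Sperner_iff[OF F'V V(1)]
  proof (intro ballI impI)
    fix A B assume "A \<in> F'" "B \<in> F'" "A \<noteq> B"
    then show "\<not> A \<subseteq> B \<and> card (A - B) \<le> s"
      using D[of A B] SF[of A B] FS[of B A] SS[of A B] Scard[of A B] unfolding F'_def by blast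
  qed
  moreover have "\<forall>A\<in>F'. card A \<in> {Suc k..m}"
  proof
    fix A assume "A \<in> F'"
    then show "card A \<in> {Suc k..m}"
      using F(3)[of A] SE[of A] ks by (force simp: F'_def G_def)
  qed
  moreover have "card F \<le> card F'"
  proof -
    have "card G \<le> card S"
      unfolding S_def using V ks by (intro card_upper_shadow_ge[OF V(1) GV, of k]) (auto simp: G_def)
    moreover have "card F = card (F - G) + card G"
      using finF by (metis (no_types, lifting) G_def add.commute card_Diff_subset card_mono
          finite_subset le_add_diff_inverse mem_Collect_eq subsetI)
    moreover have "card F' = card (F - G) + card S"
      \<comment> \<open>\<open>SF\<close> with \<open>C = B\<close> shows that no shadow set belongs
        to \<open>F\<close>, so the union is disjoint.\<close>
      unfolding F'_def using SF finF by (intro card_Un_disjoint) auto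
    ultimately show ?thesis by simp
  qed
  ultimately show ?thesis using F'V by blast
qed

lemma raise_minimum_size:
  fixes V :: "nat set"
  assumes V: "finite V" "2 * s \<le> card V" and m: "s \<le> m"
    and F: "F \<subseteq> Pow V" "L_differencing_Sperner {1..s} F" "\<And>A. A \<in> F \<Longrightarrow> card A \<le> m"
  obtains F' where "F' \<subseteq> Pow V" "L_differencing_Sperner {1..s} F'"
    "\<And>A. A \<in> F' \<Longrightarrow> card A \<in> {s..m}" "card F \<le> card F'"
proof -
  have "\<exists>F'. F' \<subseteq> Pow V \<and> L_differencing_Sperner {1..s} F' \<and>
           (\<forall>A\<in>F'. card A \<in> {k..m}) \<and> card F \<le> card F'" if "k \<le> s" for k
    using that
  proof (induction k)
    case 0
    then show ?case using F by (intro exI[of _ F]) auto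
  next
    case (Suc k)
    then obtain F1 where F1: "F1 \<subseteq> Pow V" "L_differencing_Sperner {1..s} F1"
      "\<And>A. A \<in> F1 \<Longrightarrow> card A \<in> {k..m}" "card F \<le> card F1" by auto
    have "k < s" using Suc.prems by simp
    from raise_minimum_size_step[OF V this m F1(1-3)] F1(4) show ?case
      by (meson le_trans)
  qed
  from this[OF order_refl] show ?thesis using that by blast
qed

lemma complement_family:
  assumes "finite V" "F \<subseteq> Pow V" "L_differencing_Sperner L F"
  shows "(-) V ` F \<subseteq> Pow V" "L_differencing_Sperner L ((-) V ` F)" "card ((-) V ` F) = card F"
    "\<And>A. A \<in> F \<Longrightarrow> card (V - A) = card V - card A"
proof -
  show "(-) V ` F \<subseteq> Pow V" by auto
  have "(V - A) - (V - B) = B - A" if "A \<in> F" "B \<in> F" for A B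
    using that assms(2) by blast
  then show "L_differencing_Sperner L ((-) V ` F)"
    using assms(3) unfolding L_differencing_Sperner_def by auto
  show "card ((-) V ` F) = card F"
    using assms(2) by (intro card_image inj_onI) blast
  show "card (V - A) = card V - card A" if "A \<in> F" for A
    using that assms(1,2) by (metis PowD card_Diff_subset finite_subset subsetD)
qed

lemma confine_sizes:
  fixes V :: "nat set"
  assumes V: "finite V" "2 * s \<le> card V"
    and F: "F \<subseteq> Pow V" "L_differencing_Sperner {1..s} F"
  obtains F' where "F' \<subseteq> Pow V" "L_differencing_Sperner {1..s} F'"
    "\<And>A. A \<in> F' \<Longrightarrow> card A \<in> {s..card V - s}" "card F \<le> card F'"
proof -
  have s: "s \<le> card V" "s \<le> card V - s" using V by auto
  have "card A \<le> card V" if "A \<in> F" for A using that F(1) V(1) by (auto intro: card_mono)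
  from raise_minimum_size[OF V s(1) F this] obtain F1 where
    F1: "F1 \<subseteq> Pow V" "L_differencing_Sperner {1..s} F1" "\<And>A. A \<in> F1 \<Longrightarrow> card A \<in> {s..card V}"
      "card F \<le> card F1" by blast
  note C = complement_family[OF V(1) F1(1,2)]
  have "card A \<le> card V - s" if "A \<in> (-) V ` F1" for A
    using that C(4) F1(3) by (fastforce intro: diff_le_mono2)
  \<comment> \<open>The result is not complemented back: the interval from \<open>s\<close> to
    \<open>card V - s\<close> is symmetric and only the size of the family matters.\<close>
  from raise_minimum_size[OF V s(2) C(1,2) this] obtain F2 where
    F2: "F2 \<subseteq> Pow V" "L_differencing_Sperner {1..s} F2" "\<And>A. A \<in> F2 \<Longrightarrow> card A \<in> {s..card V - s}"
      "card ((-) V ` F1) \<le> card F2" by blast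
  then show ?thesis using that[of F2] C(3) F1(4) by simp
qed

section \<open>Polynomial functions on a power set\<close>

interpretation set_fun: vector_space "\<lambda>(c::real) (f :: 'a set \<Rightarrow> real) X. c * f X"
  by unfold_locales (auto simp: fun_eq_iff algebra_simps)

lemma sum_fun_apply: "(\<Sum>i\<in>I. f i) x = (\<Sum>i\<in>I. f i x)"
  for f :: "'i \<Rightarrow> 'b \<Rightarrow> 'c::comm_monoid_add"
  by (induction I rule: infinite_finite_induct) auto

text \<open>Independence is stated for the indexed family, so injectivity of \<open>g\<close> comes
  for free: a repeated vector would give a relation with coefficients 1 and -1.\<close>

lemma (in vector_space) card_le_card_spanning:
  assumes "finite I" "finite T" "g ` I \<subseteq> span T"
    and indep: "\<And>c. (\<Sum>i\<in>I. scale (c i) (g i)) = 0 \<Longrightarrow> \<forall>i\<in>I. c i = 0"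
  shows "card I \<le> card T"
proof -
  have inj: "inj_on g I"
  proof (rule inj_onI, rule ccontr)
    fix i j assume ij: "i \<in> I" "j \<in> I" "g i = g j" "i \<noteq> j"
    define c where "c k = (if k = i then 1 else if k = j then - 1 else 0 :: 'a)" for k
    have "(\<Sum>k\<in>I. scale (c k) (g k)) = (\<Sum>k\<in>{i, j}. scale (c k) (g k))"
      using assms(1) ij by (intro sum.mono_neutral_right) (auto simp: c_def)
    also have "\<dots> = 0" using ij by (simp add: c_def)
    finally have "c i = 0" using indep ij by blast
    then show False by (simp add: c_def)
  qed
  have "independent (g ` I)"
  proof (rule independent_if_scalars_zero)
    fix f x assume sum: "(\<Sum>x\<in>g ` I. scale (f x) x) = 0" and x: "x \<in> g ` I"
    have "(\<Sum>i\<in>I. scale (f (g i)) (g i)) = 0"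
      using sum by (simp add: sum.reindex[OF inj])
    then show "f x = 0" using indep[of "f \<circ> g"] x by auto
  qed (use assms in simp)
  from independent_span_bound[OF assms(2) this assms(3)] show ?thesis
    using card_image[OF inj] by simp
qed

text \<open>The product of the variables indexed by \<open>J\<close>, evaluated at the 0/1 indicator
  vector of \<open>X\<close>.\<close>

definition monomial :: "'a set \<Rightarrow> 'a set \<Rightarrow> real" where
  "monomial J X = (if J \<subseteq> X then 1 else 0)"

abbreviation small_subsets :: "'a set \<Rightarrow> nat \<Rightarrow> 'a set set" where
  "small_subsets W d \<equiv> {J. J \<subseteq> W \<and> card J \<le> d}"

abbreviation poly_funs :: "'a set \<Rightarrow> nat \<Rightarrow> ('a set \<Rightarrow> real) set" where
  "poly_funs W d \<equiv> set_fun.span (monomial ` small_subsets W d)"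

lemma finite_small_subsets: "finite W \<Longrightarrow> finite (small_subsets W d)"
  by simp

lemma card_small_subsets:
  assumes "finite W"
  shows "card (small_subsets W d) = (\<Sum>i\<le>d. card W choose i)"
proof -
  have "small_subsets W d = (\<Union>i\<le>d. {J. J \<subseteq> W \<and> card J = i})" by auto
  also have "card \<dots> = (\<Sum>i\<le>d. card {J. J \<subseteq> W \<and> card J = i})"
    using assms by (intro card_UN_disjoint) auto
  finally show ?thesis using n_subsets[OF assms] by simp
qed

text \<open>\<open>card (S \<inter> X)\<close> is the sum of the variables in \<open>S\<close>. As
  0/1 variables are idempotent, multiplying \<open>monomial J\<close> by variable \<open>i\<close>
  gives \<open>monomial (insert i J)\<close>, so the degree grows by at most one.\<close>

lemma poly_funs_mult_linear:
  fixes W :: "'a set"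
  assumes "finite W" "S \<subseteq> W" "f \<in> poly_funs W d"
  shows "(\<lambda>X. (a + b * real (card (S \<inter> X))) * f X) \<in> poly_funs W (Suc d)"
  using assms(3)
proof (induction rule: set_fun.span_induct_alt)
  case base
  then show ?case using set_fun.span_zero by (simp add: zero_fun_def)
next
  case (step c g f)
  then obtain J where J: "J \<subseteq> W" "card J \<le> d" "g = monomial J" by auto
  have finS: "finite S" using assms finite_subset by blast
  have *: "(\<lambda>X. (a + b * real (card (S \<inter> X))) * g X) =
      (\<lambda>X. a * monomial J X) + (\<Sum>i\<in>S. (\<lambda>X. b * monomial (insert i J) X))"
  proof
    fix X
    have "real (card (S \<inter> X)) * monomial J X = (\<Sum>i\<in>S. monomial (insert i J) X)"
    proof (cases "J \<subseteq> X")
      case True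
      then have "(\<Sum>i\<in>S. monomial (insert i J) X) = (\<Sum>i\<in>S. if i \<in> X then 1 else 0)"
        by (auto simp: monomial_def intro!: sum.cong)
      then show ?thesis using True finS
        by (simp add: monomial_def flip: sum.inter_restrict)
    qed (auto simp: monomial_def)
    then show "(a + b * real (card (S \<inter> X))) * g X =
      ((\<lambda>X. a * monomial J X) + (\<Sum>i\<in>S. (\<lambda>X. b * monomial (insert i J) X))) X"
      using J(3) by (simp add: sum_fun_apply distrib_right mult.assoc flip: sum_distrib_left)
  qed
  have "(\<lambda>X. (a + b * real (card (S \<inter> X))) * g X) \<in> poly_funs W (Suc d)"
    unfolding *
  proof (intro set_fun.span_add set_fun.span_sum set_fun.span_scale set_fun.span_base imageI CollectI)
    fix i assume i: "i \<in> S"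
    show "insert i J \<subseteq> W \<and> card (insert i J) \<le> Suc d"
      using i J assms(1,2) by (auto intro: order_trans[OF card_insert_le_m1] simp: card_insert_if
          finite_subset[OF J(1) assms(1)])
  qed (use J in auto)
  then have "(\<lambda>X. c * ((a + b * real (card (S \<inter> X))) * g X)) +
      (\<lambda>X. (a + b * real (card (S \<inter> X))) * f X) \<in> poly_funs W (Suc d)"
    using step by (intro set_fun.span_add set_fun.span_scale)
  then show ?case by (simp add: plus_fun_def algebra_simps)
qed

lemma poly_funs_mult_prod_linear:
  assumes "finite W" "S \<subseteq> W" "f \<in> poly_funs W d" "finite K"
  shows "(\<lambda>X. (\<Prod>k\<in>K. a k + b * real (card (S \<inter> X))) * f X) \<in> poly_funs W (card K + d)"
  using assms(4)
proof (induction K rule: finite_induct)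
  case empty
  then show ?case using assms(3) by simp
next
  case (insert k K)
  from poly_funs_mult_linear[OF assms(1,2) insert.IH, of "a k" b] insert.hyps
  show ?case by (simp add: mult.assoc)
qed

text \<open>The system is triangular: by induction on \<open>card X\<close>, the proper subsets of
  \<open>X\<close> contribute nothing and only \<open>c X\<close> remains.\<close>

lemma zero_if_subset_sums_zero:
  fixes c :: "'a set \<Rightarrow> 'b::comm_monoid_add"
  assumes "finite W" "\<And>X. X \<in> small_subsets W d \<Longrightarrow> (\<Sum>I\<in>{I\<in>small_subsets W d. I \<subseteq> X}. c I) = 0"
    and "X \<in> small_subsets W d"
  shows "c X = 0"
  using assms(3)
proof (induction "card X" arbitrary: X rule: less_induct)
  case less
  have fin: "finite X" using less.prems assms(1) finite_subset by auto
  have "(\<Sum>I\<in>{I\<in>small_subsets W d. I \<subseteq> X}. c I) = (\<Sum>I\<in>{X}. c I)"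
  proof (rule sum.mono_neutral_right)
    show "\<forall>I\<in>{I \<in> small_subsets W d. I \<subseteq> X} - {X}. c I = 0"
      using less.hyps fin by (auto intro: psubset_card_mono)
  qed (use less.prems assms(1) in auto)
  then show ?case using assms(2)[OF less.prems] by simp
qed

section \<open>The bound for confined sizes\<close>

lemma card_bound_confined:
  fixes V :: "nat set"
  assumes V: "finite V" "v \<in> V" and n: "card V = n" "n + 2 \<le> 3 * s" "2 * s \<le> n"
    and F: "F \<subseteq> Pow V" "L_differencing_Sperner {1..s} F" "\<And>A. A \<in> F \<Longrightarrow> card A \<in> {s..n - s}"
  shows "card F + (\<Sum>i\<le>3 * s - n - 2. (n - 1) choose i) \<le> (\<Sum>i\<le>s. (n - 1) choose i)"
proof -
  define W where "W = V - {v}"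
  have W: "finite W" "card W = n - 1" using V n by (auto simp: W_def)
  have finF: "finite F" using F(1) V(1) by (meson finite_Pow_iff finite_subset)
  define e where "e = 3 * s - n - 2"
  let ?E = "small_subsets W e"
  \<comment> \<open>Deleting \<open>v\<close> lowers a size by at most one, so \<open>K\<close>
    contains \<open>card (B - {v}) + 1\<close> for every \<open>B\<close> in \<open>F\<close>. It
    has \<open>n - 2 * s + 2\<close> elements, which leaves degree exactly \<open>e\<close> for the
    monomial factor of \<open>h\<close>.\<close>
  define K where "K = {s..n - s + 1}"
  \<comment> \<open>Both \<open>f\<close> and \<open>h\<close> are written in the shape that
    \<open>poly_funs_mult_prod_linear\<close> expects; \<open>f_alt\<close> recovers the product
    over set differences.\<close>
  define f where "f A X = (\<Prod>l\<in>{1..s}. real (card (A - {v})) - real l + (- 1) * real (card ((A - {v}) \<inter> X)))"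
    for A X :: "nat set"
  define h where "h I X = (\<Prod>k\<in>K. 1 - real k + 1 * real (card (W \<inter> X))) * monomial I X"
    for I X :: "nat set"
  have f_alt: "f A X = (\<Prod>l\<in>{1..s}. real (card (A - {v} - X)) - real l)" if "A \<in> F" for A X
  proof -
    have "finite (A - {v})" using that F(1) V(1) by (meson PowD finite_Diff finite_subset subsetD)
    then have "card (A - {v}) = card ((A - {v}) \<inter> X) + card (A - {v} - X)"
      by (metis card_Diff_subset_Int card_mono finite_Int inf_le1 le_add_diff_inverse)
    then show ?thesis by (simp add: f_def algebra_simps)
  qed
  have f_diag: "f A (A - {v}) \<noteq> 0" if "A \<in> F" for A
    using that by (simp add: f_alt)
  \<comment> \<open>The last condition excludes \<open>v \<in> A - B\<close>, where deleting
    \<open>v\<close> would shrink the difference and could make it empty.\<close>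
  have f_off: "f A (B - {v}) = 0" if "A \<in> F" "B \<in> F" "A \<noteq> B" "v \<notin> A \<or> v \<in> B" for A B
  proof -
    have "A - {v} - (B - {v}) = A - B" using that(4) by blast
    moreover have "card (A - B) \<in> {1..s}"
      using that F(2) by (auto simp: L_differencing_Sperner_def)
    ultimately show ?thesis unfolding f_alt[OF that(1)] by (intro prod_zero) auto
  qed
  have h_F: "h I (B - {v}) = 0" if "B \<in> F" for I B
  proof -
    have "B \<subseteq> V" using that F(1) by auto
    then have B: "W \<inter> (B - {v}) = B - {v}" "finite B" using V(1) finite_subset by (auto simp: W_def)
    have "card (B - {v}) + 1 \<in> K"
      using F(3)[OF that] n by (cases "v \<in> B") (auto simp: K_def card_Diff_singleton_if)
    then have "(\<Prod>k\<in>K. 1 - real k + 1 * real (card (W \<inter> (B - {v})))) = 0"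
      unfolding B(1) by (intro prod_zero) (auto simp: K_def intro!: bexI[of _ "card (B - {v}) + 1"])
    then show ?thesis by (simp add: h_def)
  qed
  have f_poly: "f A \<in> poly_funs W s" if "A \<in> F" for A
  proof -
    have "(\<lambda>X. 1) \<in> poly_funs W 0"
      by (rule set_fun.span_base) (auto simp: monomial_def fun_eq_iff image_iff intro!: exI[of _ "{}"])
    moreover have "A - {v} \<subseteq> W" using that F(1) by (auto simp: W_def)
    ultimately have "(\<lambda>X. f A X * 1) \<in> poly_funs W (card {1..s} + 0)"
      unfolding f_def by (intro poly_funs_mult_prod_linear[OF W(1)]) auto
    then show ?thesis by simp
  qed
  have h_poly: "h I \<in> poly_funs W s" if "I \<in> ?E" for I
  proof -
    have "monomial I \<in> poly_funs W e" using that by (intro set_fun.span_base) auto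
    then have "h I \<in> poly_funs W (card K + e)"
      unfolding h_def by (intro poly_funs_mult_prod_linear[OF W(1) order_refl]) (simp_all add: K_def)
    moreover have "card K + e = s" using n by (auto simp: K_def e_def)
    ultimately show ?thesis by simp
  qed
  \<comment> \<open>The disjoint sum keeps the two kinds of indices apart, although both are sets of
    naturals.\<close>
  have "card (F <+> ?E) \<le> card (monomial ` small_subsets W s)"
  proof (rule set_fun.card_le_card_spanning)
    show "case_sum f h ` (F <+> ?E) \<subseteq> poly_funs W s"
      using f_poly h_poly by auto
  next
    fix c :: "nat set + nat set \<Rightarrow> real"
    assume "(\<Sum>i\<in>F <+> ?E. (\<lambda>X. c i * case_sum f h i X)) = 0"
    then have "(\<Sum>i\<in>F <+> ?E. c i * case_sum f h i X) = 0" for X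
      by (metis (mono_tags, lifting) sum_fun_apply sum.cong zero_fun_apply)
    then have rel: "(\<Sum>A\<in>F. c (Inl A) * f A X) + (\<Sum>I\<in>?E. c (Inr I) * h I X) = 0" for X
      using finF finite_small_subsets[OF W(1)] by (simp add: sum.Plus)
    have rel_F: "(\<Sum>A\<in>F. c (Inl A) * f A (B - {v})) = 0" if "B \<in> F" for B
      using rel[of "B - {v}"] h_F[OF that] by simp
    have single: "c (Inl B) = 0"
      if B: "B \<in> F" and z: "\<And>A. A \<in> F \<Longrightarrow> A \<noteq> B \<Longrightarrow> c (Inl A) * f A (B - {v}) = 0" for B
    proof -
      have "(\<Sum>A\<in>F. c (Inl A) * f A (B - {v})) = c (Inl B) * f B (B - {v})"
        using z by (simp add: sum.remove[OF finF B] sum.neutral)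
      then show ?thesis using rel_F[OF B] f_diag[OF B] by simp
    qed
    \<comment> \<open>The order matters: if \<open>v \<in> B\<close>, then \<open>f_off\<close>
      applies to every other \<open>A\<close>; if not, the \<open>A\<close> containing
      \<open>v\<close> already have coefficient zero and \<open>f_off\<close> covers the
      rest.\<close>
    have cv: "c (Inl B) = 0" if "B \<in> F" "v \<in> B" for B
      using that f_off by (intro single) auto
    have cF: "c (Inl B) = 0" if "B \<in> F" for B
    proof (rule single[OF that])
      show "c (Inl A) * f A (B - {v}) = 0" if "A \<in> F" "A \<noteq> B" for A
        using that \<open>B \<in> F\<close> f_off[of A B] cv[of A] by auto
    qed
    have "c (Inr X) = 0" if X: "X \<in> ?E" for X
    proof (rule zero_if_subset_sums_zero[OF W(1) _ X, where c = "\<lambda>I. c (Inr I)"])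
      fix X assume X: "X \<in> ?E"
      \<comment> \<open>The factor \<open>p\<close> is common to all \<open>h I X\<close>. It is
        nonzero because \<open>card X + 1 \<le> e + 1 < s\<close> lies below every element of
        \<open>K\<close>.\<close>
      define p where "p = (\<Prod>k\<in>K. 1 - real k + 1 * real (card (W \<inter> X)))"
      have "W \<inter> X = X" using X by auto
      moreover have "card X + 1 < s" using X n by (auto simp: e_def)
      ultimately have p: "p \<noteq> 0" by (auto simp: p_def K_def)
      have "0 = (\<Sum>I\<in>?E. c (Inr I) * h I X)"
        using rel[of X] cF by simp
      also have "\<dots> = p * (\<Sum>I\<in>?E. if I \<subseteq> X then c (Inr I) else 0)"
        by (auto simp: h_def p_def monomial_def sum_distrib_left intro!: sum.cong)
      also have "(\<Sum>I\<in>?E. if I \<subseteq> X then c (Inr I) else 0) = (\<Sum>I\<in>{I\<in>?E. I \<subseteq> X}. c (Inr I))"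
        by (rule sum.inter_filter[symmetric, OF finite_small_subsets[OF W(1)]])
      finally show "(\<Sum>I\<in>{I\<in>?E. I \<subseteq> X}. c (Inr I)) = 0" using p by simp
    qed
    then show "\<forall>i\<in>F <+> ?E. c i = 0" using cF by auto
  qed (use finF W(1) finite_small_subsets in auto)
  also have "\<dots> \<le> card (small_subsets W s)"
    using W(1) by (intro card_image_le) simp
  finally show ?thesis
    using finF finite_small_subsets[OF W(1), of e]
    by (simp add: card_Plus card_small_subsets[OF W(1)] W(2) e_def)
qed

theorem mainTheorem5:
  fixes n s :: nat and F :: "nat set set"
  assumes "n + 2 \<le> 3 * s" and "2 * s \<le> n"
    and "F \<subseteq> Pow {1..n}"
    and "L_differencing_Sperner {1..s} F"
  shows "card F \<le> (\<Sum>i = 3 * s - n - 1..s. (n - 1) choose i)"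
proof -
  obtain F' where F': "F' \<subseteq> Pow {1..n}" "L_differencing_Sperner {1..s} F'"
    "\<And>A. A \<in> F' \<Longrightarrow> card A \<in> {s..n - s}" "card F \<le> card F'"
    using confine_sizes[of "{1..n}" s F] assms by auto
  let ?m = "3 * s - n - 2"
  \<comment> \<open>Since \<open>n + 2 \<le> 3 * s\<close>, no subtraction is truncated, and the
    claimed range starts just above \<open>?m\<close>.\<close>
  have m: "3 * s - n - 1 = Suc ?m" "Suc ?m \<le> s" using assms(1,2) by auto
  have "n \<in> {1..n}" using assms(1,2) by auto
  from card_bound_confined[OF _ this _ assms(1,2) F'(1-3)]
  have "card F' + (\<Sum>i\<le>?m. (n - 1) choose i) \<le> (\<Sum>i\<le>s. (n - 1) choose i)" by simp
  also have "{..s} = {..?m} \<union> {Suc ?m..s}" using m(2) by auto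
  also have "(\<Sum>i\<in>\<dots>. (n - 1) choose i) =
      (\<Sum>i\<le>?m. (n - 1) choose i) + (\<Sum>i = Suc ?m..s. (n - 1) choose i)"
    by (rule sum.union_disjoint) auto
  finally show ?thesis using F'(4) m(1) by simp
qed

end
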